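(* For $t\ge 1$, $$\frac{d}{dt}\left(N(t)e^{-\frac{e}{e-1}t}\right)=-\frac{e}{e-1}e^{-\frac{e}{e-1}t}N(t-1)-e^{-\frac{e}{e-1}t}.$$
   Context: For real $t\ge 0$, $N(t)$ denotes the expected number of selections when numbers are selected independently and uniformly at random from the interval $[1,e]$ until their product is greater than $e^t$. That is, $N(t)$ is the expected value of $\min\{n\ge 1: Z_1Z_2\cdots Z_n>e^t\}$, where $Z_1,Z_2,\ldots$ are i.i.d. uniform on $[1,e]$.
   Formalization: At t = 1 the derivative is taken as the right-hand derivative, because the left and right derivatives of N(t)e^{-et/(e-1)} differ there and no two-sided derivative exists; for t > 1 it is the ordinary derivative. *)

theory Defs
  imports "HOL-Probability.Probability"
begin

text \<open>
  For \<^term>\<open>i \<ge> 1\<close> the number \<^term>\<open>Z i \<omega>\<close> is the outcome of the \<^term>\<open>i\<close>-th draw.  If no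
  partial product exceeds \<^term>\<open>exp t\<close>, the minimum does not exist and \<^const>\<open>Least\<close> returns an
  arbitrary value; for i.i.d. draws uniform on \<^term>\<open>{1..exp 1 :: real}\<close> such outcomes form a
  null set.
\<close>

definition selections :: "(nat \<Rightarrow> 'a \<Rightarrow> real) \<Rightarrow> real \<Rightarrow> 'a \<Rightarrow> nat" where
  "selections Z t \<omega> = (LEAST n. 1 \<le> n \<and> (\<Prod>i=1..n. Z i \<omega>) > exp t)"

definition expected_selections :: "'a measure \<Rightarrow> (nat \<Rightarrow> 'a \<Rightarrow> real) \<Rightarrow> real \<Rightarrow> real" where
  "expected_selections M Z t = prob_space.expectation M (\<lambda>\<omega>. real (selections Z t \<omega>))"

end

theory Submission imports Defs begin

text \<open>
  The number of selections until the product exceeds \<^term>\<open>exp t\<close> is the number of indices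
  \<open>n \<ge> 0\<close> for which the product of the first \<open>n\<close> draws is still at most \<^term>\<open>exp t\<close>, because
  the draws are at least 1 and the partial products therefore increase.  So \<open>N t = R t\<close> for
  \<open>t \<ge> 0\<close>, where \<open>R t\<close> is the sum over \<open>n\<close> of \<open>F n t\<close>, the probability that the logarithm of the
  \<open>n\<close>-th product is at most \<open>t\<close>: \<open>R\<close> is the renewal function of the random walk with steps
  \<open>ln (Z i)\<close>.

  Such a step has density \<open>exp x / (e - 1)\<close> on \<open>[0, 1]\<close>, where \<open>e = exp 1\<close>.  Splitting off one
  independent draw writes \<open>F (n + 1) t\<close> as the integral of \<open>F n y * exp (t - y) / (e - 1)\<close> over
  \<open>[t - 1, t]\<close>.  The recursion has two consequences.  By induction,
  \<open>F n t \<le> exp t / (e - 1)^n\<close>, so that \<open>R\<close> is finite, since \<open>e > 2\<close>, and almost every outcome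
  stops.  Summed over \<open>n\<close>, the recursion becomes the renewal equation: for \<open>t \<ge> 0\<close>,
  \<open>R t = 1 + exp t / (e - 1) * I t\<close>, where \<open>I t\<close> is the integral of \<open>R y * exp (- y)\<close> over
  \<open>[t - 1, t]\<close>.

  The rest is calculus.  The renewal equation expresses \<open>R\<close> on \<open>[0, \<infinity>)\<close> through indefinite
  integrals, which makes \<open>R\<close> continuous there; the fundamental theorem of calculus then
  differentiates \<open>I\<close> on \<open>[1, \<infinity>)\<close> and gives \<open>R' t = e / (e - 1) * (R t - R (t - 1)) - 1\<close>.  The
  factor \<open>exp (- e / (e - 1) * t)\<close> absorbs the term with \<open>R t\<close>.
\<close>

section \<open>Draws and their partial products\<close>

text \<open>It makes \<open>1 / (exp 1 - 1)\<close>, the ratio of the geometric series that will dominate the renewal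
  function, smaller than 1.\<close>

lemma exp_1_gt_2: "exp 1 > (2::real)"
  using exp_lower_Taylor_quadratic[of 1] by simp

locale uniform_draws = prob_space M for M :: "'a measure" +
  fixes Z :: "nat \<Rightarrow> 'a \<Rightarrow> real"
  assumes indep: "indep_vars (\<lambda>_. borel) Z {1..}"
    and uniform: "\<And>i. 1 \<le> i \<Longrightarrow>
      distributed M lborel (Z i) (\<lambda>x. indicator {1..exp 1} x / measure lborel {1..exp 1 :: real})"
begin

lemma draw_measurable [measurable]: "1 \<le> i \<Longrightarrow> Z i \<in> borel_measurable M"
  using distributed_measurable[OF uniform] by simp

lemma partial_product_measurable [measurable]:
  "(\<lambda>\<omega>. \<Prod>i=1..n. Z i \<omega>) \<in> borel_measurable M"
  by (intro borel_measurable_prod) auto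

lemma draw_distr:
  "1 \<le> i \<Longrightarrow> distr M borel (Z i) = density lborel (\<lambda>z. ennreal (indicator {1..exp 1} z / (exp 1 - 1)))"
proof -
  assume "1 \<le> i"
  have "distr M borel (Z i) = distr M lborel (Z i)"
    by (intro distr_cong) auto
  also have "\<dots> = density lborel (\<lambda>x. indicator {1..exp 1} x / measure lborel {1..exp 1 :: real})"
    by (rule distributed_distr_eq_density[OF uniform[OF \<open>1 \<le> i\<close>]])
  also have "\<dots> = density lborel (\<lambda>z. ennreal (indicator {1..exp 1} z / (exp 1 - 1)))"
    using exp_1_gt_2 by (intro density_cong) (auto simp: divide_ennreal[symmetric] ennreal_indicator)
  finally show ?thesis .
qed

lemma AE_draws_ge_1: "AE \<omega> in M. \<forall>i\<ge>1. 1 \<le> Z i \<omega>"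
proof -
  have "AE \<omega> in M. 1 \<le> i \<longrightarrow> 1 \<le> Z i \<omega>" for i
  proof (cases "1 \<le> i")
    case True
    have "AE z in distr M borel (Z i). 1 \<le> z"
      unfolding draw_distr[OF True] by (subst AE_density) (auto simp: indicator_def)
    then have "AE \<omega> in M. 1 \<le> Z i \<omega>"
      by (rule AE_distrD[OF draw_measurable[OF True]])
    then show ?thesis by (rule AE_mp) simp
  qed simp
  then show ?thesis by (subst AE_all_countable) blast
qed

text \<open>The distribution function of the logarithm of the \<open>n\<close>-th partial product.  On the
  logarithmic scale the recursion over \<open>n\<close> is a convolution.\<close>

definition log_product_cdf :: "nat \<Rightarrow> real \<Rightarrow> real" where
  "log_product_cdf n t = prob {\<omega> \<in> space M. (\<Prod>i=1..n. Z i \<omega>) \<le> exp t}"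

lemma log_product_cdf_nonneg: "0 \<le> log_product_cdf n t"
  by (simp add: log_product_cdf_def)

lemma log_product_cdf_0: "log_product_cdf 0 t = (if 0 \<le> t then 1 else 0)"
  by (simp add: log_product_cdf_def prob_space)

lemma mono_log_product_cdf: "mono (log_product_cdf n)"
  unfolding log_product_cdf_def
  by (intro monoI finite_measure_mono) (auto intro: order_trans simp del: One_nat_def)

lemma log_product_cdf_measurable [measurable]: "log_product_cdf n \<in> borel_measurable borel"
  by (intro borel_measurable_mono mono_log_product_cdf)

text \<open>
  Conditioning on the last draw \<open>z\<close>, which is independent of the product of the others, the
  event becomes that this product is at most \<open>exp (t - ln z)\<close>.  The substitution
  \<open>z = exp (t - y)\<close> turns the average over \<open>z\<close> into a convolution; it is carried out in the two
  steps \<open>z = exp x\<close> and \<open>x = t - y\<close>, because the substitution rule wants an increasing function.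
\<close>

lemma log_product_cdf_Suc:
  "ennreal (log_product_cdf (Suc n) t) =
    (\<integral>\<^sup>+y. ennreal (log_product_cdf n y * exp (t - y) / (exp 1 - 1) * indicator {t-1..t} y) \<partial>lborel)"
proof -
  let ?P = "\<lambda>\<omega>. \<Prod>i=1..n. Z i \<omega>"
  let ?S = "{p. fst p * snd p \<le> exp t} :: (real \<times> real) set"
  have e: "exp 1 - 1 > (0::real)" using exp_1_gt_2 by simp
  have "indep_vars (\<lambda>_. borel) Z (insert (Suc n) {1..n})"
    by (rule indep_vars_subset[OF indep]) auto
  then have "indep_var borel (Z (Suc n)) borel ?P"
    by (intro indep_vars_prod) auto
  then have joint: "distr M borel (Z (Suc n)) \<Otimes>\<^sub>M distr M borel ?P
      = distr M (borel \<Otimes>\<^sub>M borel) (\<lambda>\<omega>. (Z (Suc n) \<omega>, ?P \<omega>))"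
    by (simp add: indep_var_distribution_eq)
  interpret D: prob_space "distr M borel ?P" by (rule prob_space_distr) simp
  have S [measurable]: "?S \<in> sets (borel \<Otimes>\<^sub>M borel)"
    unfolding borel_prod by (intro borel_closed closed_Collect_le continuous_intros)
  have "ennreal (log_product_cdf (Suc n) t) = emeasure M {\<omega> \<in> space M. Z (Suc n) \<omega> * ?P \<omega> \<le> exp t}"
    unfolding log_product_cdf_def emeasure_eq_measure
    by (simp add: mult.commute del: One_nat_def)
  also have "\<dots> = emeasure (distr M (borel \<Otimes>\<^sub>M borel) (\<lambda>\<omega>. (Z (Suc n) \<omega>, ?P \<omega>))) ?S"
    by (subst emeasure_distr) (auto intro!: arg_cong[where f="emeasure M"] simp del: One_nat_def)
  also have "\<dots> = (\<integral>\<^sup>+z. emeasure (distr M borel ?P) (Pair z -` ?S) \<partial>distr M borel (Z (Suc n)))"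
    unfolding joint[symmetric] by (rule D.emeasure_pair_measure_alt) simp
  also have "\<dots> = (\<integral>\<^sup>+z. ennreal (indicator {1..exp 1} z / (exp 1 - 1)) *
      emeasure (distr M borel ?P) (Pair z -` ?S) \<partial>lborel)"
  proof -
    have "?S \<in> sets (borel \<Otimes>\<^sub>M distr M borel ?P)"
      using S by (simp cong: sets_pair_measure_cong)
    from D.measurable_emeasure_Pair[OF this] show ?thesis
      by (subst draw_distr) (auto simp: nn_integral_density)
  qed
  also have "\<dots> = (\<integral>\<^sup>+z. ennreal (log_product_cdf n (t - ln z) / (exp 1 - 1) * indicator {exp 0..exp 1} z) \<partial>lborel)"
  proof (rule nn_integral_cong)
    fix z :: real
    show "ennreal (indicator {1..exp 1} z / (exp 1 - 1)) * emeasure (distr M borel ?P) (Pair z -` ?S)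
      = ennreal (log_product_cdf n (t - ln z) / (exp 1 - 1) * indicator {exp 0..exp 1} z)"
    proof (cases "z \<in> {1..exp 1}")
      case True
      then have "y \<le> exp (t - ln z) \<longleftrightarrow> z * y \<le> exp t" for y
        by (simp add: exp_diff pos_le_divide_eq mult.commute)
      with True have "emeasure (distr M borel ?P) (Pair z -` ?S) = ennreal (log_product_cdf n (t - ln z))"
        unfolding log_product_cdf_def emeasure_eq_measure[symmetric]
        by (subst emeasure_distr)
          (auto intro!: arg_cong[where f="emeasure M"] simp del: One_nat_def)
      with True e show ?thesis
        by (simp add: log_product_cdf_nonneg ennreal_mult[symmetric])
    qed auto
  qed
  also have "\<dots> = (\<integral>\<^sup>+x. ennreal (log_product_cdf n (t - ln (exp x)) / (exp 1 - 1) * exp x * indicator {0..1} x) \<partial>lborel)"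
  proof (rule nn_integral_substitution)
    show "set_borel_measurable borel {exp 0..exp 1} (\<lambda>z. log_product_cdf n (t - ln z) / (exp 1 - 1))"
      unfolding set_borel_measurable_def by measurable
  qed (auto intro!: derivative_eq_intros continuous_intros)
  also have "\<dots> = (\<integral>\<^sup>+y. ennreal (log_product_cdf n y * exp (t - y) / (exp 1 - 1) * indicator {t-1..t} y) \<partial>lborel)"
    by (subst nn_integral_real_affine[where t=t and c="-1"])
      (auto intro!: nn_integral_cong simp: indicator_def)
  finally show ?thesis .
qed

section \<open>The renewal function and the renewal equation\<close>

text \<open>
  This is the bound that Markov's inequality gives for the reciprocal of the product, as
  \<open>1 / Z i\<close> has mean \<open>1 / (exp 1 - 1)\<close>.  In the induction, the factor
  \<open>exp (t - y)\<close> in the recursion cancels the \<open>exp y\<close> of the induction hypothesis, which leaves a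
  constant integrand on an interval of length 1.
\<close>

lemma log_product_cdf_le: "log_product_cdf n t \<le> exp t / (exp 1 - 1) ^ n"
proof (induction n arbitrary: t)
  case 0
  then show ?case by (simp add: log_product_cdf_0)
next
  case (Suc n)
  have e: "exp 1 - 1 > (0::real)" using exp_1_gt_2 by simp
  let ?b = "exp t / (exp 1 - 1) ^ Suc n"
  have step: "log_product_cdf n y * exp (t - y) / (exp 1 - 1) \<le> ?b" for y
  proof -
    have "log_product_cdf n y * exp (t - y) \<le> exp y / (exp 1 - 1) ^ n * exp (t - y)"
      by (intro mult_right_mono Suc) simp
    also have "\<dots> = exp t / (exp 1 - 1) ^ n"
      by (simp add: exp_diff)
    finally have "log_product_cdf n y * exp (t - y) / (exp 1 - 1) \<le> exp t / (exp 1 - 1) ^ n / (exp 1 - 1)"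
      using e by (intro divide_right_mono) auto
    then show ?thesis by (simp add: mult.commute)
  qed
  have "ennreal (log_product_cdf (Suc n) t) \<le> (\<integral>\<^sup>+y. ennreal ?b * indicator {t-1..t} y \<partial>lborel)"
    unfolding log_product_cdf_Suc
    by (intro nn_integral_mono) (use step in \<open>auto simp: indicator_def intro!: ennreal_leI\<close>)
  also have "\<dots> = ennreal ?b"
    by (subst nn_integral_cmult_indicator) auto
  finally show ?case
    using e by (subst (asm) ennreal_le_iff) auto
qed

lemma summable_log_product_cdf: "summable (\<lambda>n. log_product_cdf n t)"
proof (rule summable_comparison_test')
  show "summable (\<lambda>n. exp t * (1 / (exp 1 - 1 :: real)) ^ n)"
    using exp_1_gt_2 by (intro summable_mult summable_geometric) simp
  show "norm (log_product_cdf n t) \<le> exp t * (1 / (exp 1 - 1)) ^ n" if "n \<ge> 0" for n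
    using log_product_cdf_le[of n t] log_product_cdf_nonneg[of n t] by (simp add: power_one_over)
qed

text \<open>The sum starts at \<open>n = 0\<close>, with the empty product: this term is 1 for \<open>t \<ge> 0\<close> and counts
  the first selection, which is always made.\<close>

definition renewal_function :: "real \<Rightarrow> real" where
  "renewal_function t = (\<Sum>n. log_product_cdf n t)"

lemma renewal_function_nonneg: "0 \<le> renewal_function t"
  unfolding renewal_function_def
  by (intro suminf_nonneg summable_log_product_cdf log_product_cdf_nonneg)

lemma renewal_function_measurable [measurable]: "renewal_function \<in> borel_measurable borel"
  unfolding renewal_function_def[abs_def] by measurable

lemma ennreal_renewal_function: "ennreal (renewal_function t) = (\<Sum>n. ennreal (log_product_cdf n t))"
  unfolding renewal_function_def
  by (intro suminf_ennreal2[symmetric] summable_log_product_cdf log_product_cdf_nonneg)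

text \<open>
  The recursion for the single terms, summed by monotone convergence; the subtracted 1 is
  the term \<open>n = 0\<close>, which the recursion does not produce.  Dividing by \<open>exp t\<close> frees the integrand of \<open>t\<close>, so that \<open>t\<close> enters
  the integral only through its limits and the equation can be differentiated.
\<close>

lemma renewal_equation:
  assumes "0 \<le> t"
  shows "((\<lambda>y. renewal_function y * exp (- y)) has_integral
    (renewal_function t - 1) * (exp 1 - 1) * exp (- t)) {t-1..t}"
proof -
  let ?k = "\<lambda>y. exp (t - y) / (exp 1 - 1) * indicator {t-1..t} y :: real"
  have e: "exp 1 - 1 > (0::real)" using exp_1_gt_2 by simp
  have k: "0 \<le> ?k y" for y using e by simp
  have tail: "renewal_function t - 1 = (\<Sum>n. log_product_cdf (Suc n) t)"
    using assms unfolding renewal_function_def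
    by (simp add: suminf_split_head[OF summable_log_product_cdf] log_product_cdf_0)
  have summable_tail: "summable (\<lambda>n. log_product_cdf (Suc n) t)"
    by (subst summable_Suc_iff) (rule summable_log_product_cdf)
  have "ennreal (renewal_function t - 1) = (\<Sum>n. ennreal (log_product_cdf (Suc n) t))"
    unfolding tail
    by (intro suminf_ennreal2[symmetric] summable_tail log_product_cdf_nonneg)
  also have "\<dots> = (\<Sum>n. \<integral>\<^sup>+y. ennreal (log_product_cdf n y) * ennreal (?k y) \<partial>lborel)"
    by (simp only: log_product_cdf_Suc ennreal_mult[OF log_product_cdf_nonneg k, symmetric])
      (simp add: mult.assoc)
  also have "\<dots> = (\<integral>\<^sup>+y. (\<Sum>n. ennreal (log_product_cdf n y) * ennreal (?k y)) \<partial>lborel)"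
    by (rule nn_integral_suminf[symmetric]) measurable
  also have "\<dots> = (\<integral>\<^sup>+y. ennreal (renewal_function y * ?k y) \<partial>lborel)"
    by (simp only: ennreal_suminf_multc ennreal_renewal_function[symmetric]
        ennreal_mult[OF renewal_function_nonneg k])
  finally have *: "(\<integral>\<^sup>+y. ennreal (renewal_function y * ?k y) \<partial>lborel) = ennreal (renewal_function t - 1)" ..
  have "((\<lambda>y. renewal_function y * ?k y) has_integral (renewal_function t - 1)) UNIV"
  proof (rule nn_integral_has_integral[OF _ _ *])
    show "0 \<le> renewal_function t - 1"
      unfolding tail by (intro suminf_nonneg summable_tail log_product_cdf_nonneg)
    show "0 \<le> renewal_function y * ?k y" for y
      by (intro mult_nonneg_nonneg renewal_function_nonneg k)
  qed measurable
  then have "((\<lambda>y. if y \<in> {t-1..t} then renewal_function y * (exp (t - y) / (exp 1 - 1)) else 0)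
      has_integral (renewal_function t - 1)) UNIV"
    by (rule has_integral_eq_rhs[OF has_integral_eq, rotated 1]) (auto simp: indicator_def)
  then have "((\<lambda>y. renewal_function y * (exp (t - y) / (exp 1 - 1))) has_integral (renewal_function t - 1)) {t-1..t}"
    by (simp only: has_integral_restrict_UNIV)
  from has_integral_mult_right[OF this, of "(exp 1 - 1) * exp (- t)"]
  moreover have "(exp 1 - 1) * exp (- t) * (renewal_function y * (exp (t - y) / (exp 1 - 1)))
      = renewal_function y * exp (- y)" for y
    using e by (simp add: exp_diff exp_minus field_simps)
  ultimately show ?thesis
    by (simp only: mult_ac)
qed

section \<open>The expected number of selections\<close>

text \<open>The partial products increase, so the indices whose product is at most \<^term>\<open>exp t\<close> form an
  initial segment \<open>{0, ..., n - 1}\<close>, where \<open>n\<close> is the stopping index.  For \<open>t \<ge> 0\<close> the empty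
  product does not exceed \<^term>\<open>exp t\<close>, which reconciles counting from 0 with a minimum over
  \<open>n \<ge> 1\<close>.\<close>

lemma selections_eq_sum:
  assumes "\<forall>i\<ge>1. 1 \<le> Z i \<omega>" and "\<exists>n. (\<Prod>i=1..n. Z i \<omega>) > exp t" and "0 \<le> t"
  shows "ennreal (real (selections Z t \<omega>)) = (\<Sum>n. indicator {n. (\<Prod>i=1..n. Z i \<omega>) \<le> exp t} n)"
proof -
  let ?P = "\<lambda>n. \<Prod>i=1..n. Z i \<omega>"
  have "incseq ?P"
  proof (rule incseq_SucI)
    fix n
    have "0 \<le> ?P n" using assms(1) by (intro prod_nonneg) (auto intro: order_trans[of 0 1])
    then show "?P n \<le> ?P (Suc n)"
      using assms(1) mult_left_mono[of 1 "Z (Suc n) \<omega>" "?P n"] by simp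
  qed
  obtain m where m: "?P m > exp t" using assms(2) ..
  have "1 \<le> m"
    using m assms(3) by (cases m) auto
  with m have "1 \<le> selections Z t \<omega> \<and> exp t < ?P (selections Z t \<omega>)"
    unfolding selections_def by (rule_tac LeastI[where k=m]) simp
  moreover have "?P n \<le> exp t" if "n < selections Z t \<omega>" for n
    using not_less_Least[OF that[unfolded selections_def]] assms(3) by (cases n) auto
  ultimately have "{n. ?P n \<le> exp t} = {..<selections Z t \<omega>}"
    using incseqD[OF \<open>incseq ?P\<close>] by (auto simp: not_less) (meson not_less order_trans)
  then have "(\<Sum>n. indicator {n. ?P n \<le> exp t} n :: ennreal) = (\<Sum>n<selections Z t \<omega>. 1)"
    by (subst suminf_finite[where N="{..<selections Z t \<omega>}"]) auto
  then show ?thesis by (simp add: ennreal_of_nat_eq_real_of_nat)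
qed

text \<open>
  The expectation of the sum of indicators.  By the Borel--Cantelli lemma and the
  convergence of the series, almost every outcome has a product above \<^term>\<open>exp t\<close>, so the
  outcomes for which the minimum does not exist do not contribute.
\<close>

lemma expected_selections_eq_renewal_function:
  assumes "0 \<le> t"
  shows "expected_selections M Z t = renewal_function t"
proof -
  let ?A = "\<lambda>n. {\<omega> \<in> space M. (\<Prod>i=1..n. Z i \<omega>) \<le> exp t}"
  have A [measurable]: "?A n \<in> sets M" for n by measurable
  have prob_A: "prob (?A n) = log_product_cdf n t" for n
    by (simp add: log_product_cdf_def)
  have "AE \<omega> in M. \<forall>\<^sub>F n in sequentially. \<omega> \<in> space M - ?A n"
    by (intro borel_cantelli_AE1 A)
      (auto simp: prob_A summable_log_product_cdf emeasure_eq_measure simp del: One_nat_def)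
  then have exceed: "AE \<omega> in M. \<exists>n. (\<Prod>i=1..n. Z i \<omega>) > exp t"
  proof eventually_elim
    case (elim \<omega>)
    then obtain n where "\<omega> \<in> space M - ?A n"
      using eventually_happens'[OF sequentially_bot] by blast
    then show ?case by (auto simp: not_le)
  qed
  have "AE \<omega> in M. ennreal (real (selections Z t \<omega>)) = (\<Sum>n. indicator (?A n) \<omega>)"
    using AE_draws_ge_1 exceed AE_space
  proof eventually_elim
    case (elim \<omega>)
    then show ?case
      using selections_eq_sum[OF elim(1,2) assms] by (simp add: indicator_def del: One_nat_def)
  qed
  then have "(\<integral>\<^sup>+\<omega>. ennreal (real (selections Z t \<omega>)) \<partial>M) = (\<integral>\<^sup>+\<omega>. (\<Sum>n. indicator (?A n) \<omega>) \<partial>M)"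
    by (rule nn_integral_cong_AE)
  also have "\<dots> = (\<Sum>n. ennreal (log_product_cdf n t))"
    by (subst nn_integral_suminf) (auto simp: emeasure_eq_measure prob_A simp del: One_nat_def)
  finally have nn: "(\<integral>\<^sup>+\<omega>. ennreal (real (selections Z t \<omega>)) \<partial>M) = ennreal (renewal_function t)"
    by (simp add: ennreal_renewal_function)
  have "(\<lambda>\<omega>. real (selections Z t \<omega>)) \<in> borel_measurable M"
    unfolding selections_def by measurable
  then show ?thesis
    unfolding expected_selections_def
    by (subst integral_eq_nn_integral) (auto simp: nn renewal_function_nonneg)
qed

end

section \<open>Differentiating the renewal equation\<close>

text \<open>
  The equation improves regularity: it makes \<open>R y * exp (- y)\<close> integrable on bounded intervals
  from -1 on; hence \<open>R\<close>, as an expression in indefinite integrals, is continuous on \<open>[0, \<infinity>)\<close>, and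
  then, for the same reason, differentiable on \<open>[1, \<infinity>)\<close>.  Below 0
  it says nothing about continuity, and for the distribution at hand \<open>R\<close> does jump at 0.  So
  the argument \<open>t - 1\<close> may not drop below 0 and the derivative is taken within \<open>[1, \<infinity>)\<close>.
\<close>

lemma renewal_equation_imp_has_derivative:
  fixes R :: "real \<Rightarrow> real"
  assumes c: "c \<noteq> 0"
    and renewal: "\<And>s. 0 \<le> s \<Longrightarrow> ((\<lambda>y. R y * exp (- y)) has_integral (R s - 1) * c * exp (- s)) {s-1..s}"
    and t: "1 \<le> t"
  shows "(R has_real_derivative (1 + 1 / c) * R t - 1 - exp 1 / c * R (t - 1)) (at t within {1..})"
proof -
  define g where "g = (\<lambda>y. R y * exp (- y))"
  \<comment> \<open>The equation at 0, 1, 2, ... gives integrability on consecutive unit intervals from -1 on.\<close>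
  have int_nat: "g integrable_on {-1..real n}" for n
  proof (induction n)
    case 0
    then show ?case using renewal[of 0] by (auto simp: g_def integrable_on_def)
  next
    case (Suc n)
    moreover have "g integrable_on {real n..real (Suc n)}"
      using renewal[of "real (Suc n)"] by (auto simp: g_def integrable_on_def)
    ultimately show ?case
      using Henstock_Kurzweil_Integration.integrable_combine[of "-1" "real n" "real (Suc n)" g] by simp
  qed
  have int: "g integrable_on {a..b}" if "-1 \<le> a" for a b
  proof -
    obtain n where "b \<le> real n" using real_arch_simple by blast
    with that show ?thesis by (intro integrable_subinterval_real[OF int_nat[of n]]) auto
  qed
  have R_eq: "R s = 1 + exp s / c * integral {s-1..s} g" if "0 \<le> s" for s
    using integral_unique[OF renewal[OF that]] c by (simp add: g_def exp_minus field_simps)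
  define b where "b = t + 1"
  \<comment> \<open>The integrals start at -1, since \<open>s - 1\<close> can be that small.\<close>
  have "continuous_on {0..b} (\<lambda>s. 1 + exp s / c * (integral {-1..s} g - integral {-1..s-1} g))"
  proof -
    have cont: "continuous_on {-1..b} (\<lambda>s. integral {-1..s} g)"
      by (intro indefinite_integral_continuous_1 int) simp
    have "continuous_on {0..b} (\<lambda>s. integral {-1..s-1} g)"
      by (rule continuous_on_compose2[OF cont]) (auto intro!: continuous_intros)
    moreover have "continuous_on {0..b} (\<lambda>s. integral {-1..s} g)"
      by (rule continuous_on_subset[OF cont]) auto
    ultimately show ?thesis using c by (intro continuous_intros) auto
  qed
  moreover have "1 + exp s / c * (integral {-1..s} g - integral {-1..s-1} g) = R s" if "s \<in> {0..b}" for s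
    using that Henstock_Kurzweil_Integration.integral_combine[of "-1" "s-1" s g] int[of "-1" s]
    by (simp add: R_eq)
  ultimately have "continuous_on {0..b} R"
    by (rule continuous_on_eq)
  then have cont_g: "continuous_on {0..b} g"
    unfolding g_def by (intro continuous_intros)
  \<comment> \<open>From here on the integrals start at 0: \<open>g\<close> is known to be continuous only to the right of it.\<close>
  let ?G = "\<lambda>s. integral {0..s} g"
  have window: "integral {s-1..s} g = ?G s - ?G (s - 1)" if "1 \<le> s" for s
    using that Henstock_Kurzweil_Integration.integral_combine[of 0 "s-1" s g] int[of 0 s] by simp
  have G: "(?G has_real_derivative g s) (at s within {0..b})" if "s \<in> {0..b}" for s
    by (rule integral_has_real_derivative[OF cont_g that])
  have within: "at t within {1..} = at t within {1..b}"
    by (rule at_within_nhd[of _ "{..<b}"]) (auto simp: b_def)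
  have G1: "(?G has_real_derivative g t) (at t within {1..})"
    unfolding within by (rule DERIV_subset[OF G]) (use t in \<open>auto simp: b_def\<close>)
  have G2: "((\<lambda>s. ?G (s - 1)) has_real_derivative g (t - 1) * 1) (at t within {1..})"
    unfolding within
  proof (rule DERIV_image_chain[where f="?G" and g="\<lambda>s. s - 1", unfolded o_def])
    show "(?G has_real_derivative g (t - 1)) (at (t - 1) within (\<lambda>s. s - 1) ` {1..b})"
      by (rule DERIV_subset[OF G]) (use t in \<open>auto simp: b_def\<close>)
  qed (auto intro!: derivative_eq_intros)
  have "((\<lambda>s. 1 + exp s / c * (?G s - ?G (s - 1))) has_real_derivative
      (1 + 1 / c) * R t - 1 - exp 1 / c * R (t - 1)) (at t within {1..})"
  proof -
    have Rt: "exp t * (?G t - ?G (t - 1)) = c * (R t - 1)"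
      using t c by (simp add: R_eq window)
    have "exp t / c * (?G t - ?G (t - 1)) + (g t - g (t - 1)) * (exp t / c)
        = (1 + 1 / c) * R t - 1 - exp 1 / c * R (t - 1)"
      using Rt c by (simp add: g_def exp_diff exp_minus divide_simps) (simp add: algebra_simps)
    with DERIV_add[OF DERIV_const[of 1] DERIV_mult[OF DERIV_cdivide[OF
        has_field_derivative_at_within[OF DERIV_exp], of c] DERIV_diff[OF G1 G2]]]
    show ?thesis by simp
  qed
  then show ?thesis
  proof (rule has_field_derivative_transform_within[where d=1])
    fix s :: real assume "s \<in> {1..}"
    then show "1 + exp s / c * (?G s - ?G (s - 1)) = R s"
      by (simp add: R_eq window)
  qed (use t in auto)
qed

theorem theorem5:
  fixes M :: "'a measure" and Z :: "nat \<Rightarrow> 'a \<Rightarrow> real" and N :: "real \<Rightarrow> real" and t :: real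
  assumes "prob_space M"
    and "prob_space.indep_vars M (\<lambda>_. borel) Z {1..}"
    and "\<And>i. 1 \<le> i \<Longrightarrow>
      distributed M lborel (Z i) (\<lambda>x. indicator {1..exp 1} x / measure lborel {1..exp 1 :: real})"
  defines "N \<equiv> expected_selections M Z"
  assumes "1 \<le> t"
  shows "((\<lambda>s. N s * exp (- (exp 1 / (exp 1 - 1)) * s)) has_real_derivative
          - (exp 1 / (exp 1 - 1)) * exp (- (exp 1 / (exp 1 - 1)) * t) * N (t - 1)
          - exp (- (exp 1 / (exp 1 - 1)) * t)) (at t within {1..})"
proof -
  interpret prob_space M by fact
  interpret uniform_draws M Z
    by unfold_locales (fact assms)+
  define a :: real where "a = exp 1 / (exp 1 - 1)"
  have e: "exp 1 - 1 > (0::real)" using exp_1_gt_2 by simp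
  then have a: "1 + 1 / (exp 1 - 1) = a" by (simp add: a_def field_simps)
  have N: "N s = renewal_function s" if "0 \<le> s" for s
    unfolding N_def by (rule expected_selections_eq_renewal_function[OF that])
  have R: "(renewal_function has_real_derivative a * N t - 1 - a * N (t - 1)) (at t within {1..})"
    using renewal_equation_imp_has_derivative[of "exp 1 - 1" renewal_function t]
      renewal_equation e \<open>1 \<le> t\<close> by (simp add: a a_def[symmetric] N)
  have "((\<lambda>s. renewal_function s * exp (- a * s)) has_real_derivative
      - a * exp (- a * t) * N (t - 1) - exp (- a * t)) (at t within {1..})"
    using \<open>1 \<le> t\<close> by (auto intro!: derivative_eq_intros R simp: N algebra_simps)
  then show ?thesis
    unfolding a_def[symmetric]
    by (rule has_field_derivative_transform_within[where d=1]) (use \<open>1 \<le> t\<close> in \<open>auto simp: N\<close>)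
qed

end
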